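(* Let $C = EFE^T$, where $E \in \mathbb{R}^{m\times p}$ and $F \in \mathbb{R}^{p\times p}$ is symmetric and nonsingular, $p = \operatorname{rank}(C)$, and let $G$ be chosen such that the matrix $\begin{bmatrix} G & 0 \\ 0 & F^{-1}\end{bmatrix}$ is symmetric and positive definite on $\mathrm{Null}(N)$, where $N = \begin{bmatrix} B & E \end{bmatrix}$. Let $q_0 \in \mathbb{R}^m$ be arbitrary. Then the Projected Lanczos Process with starting guesses $x_0 \in \mathbb{R}^n$ and $w_0 = -FE^Tq_0$, such that $Bx_0 + Ew_0 = 0$, is equivalent to the Constraint-Preconditioned (CP) Lanczos Process with starting guesses $x_0$ and $q_0$. In particular, for all $k$ (for which they are generated), the vectors $v_{k,x}$ and $v_{k,w}$ and the scalars $\alpha_k$ and $\beta_k$ in the Projected Lanczos Process are equal, respectively, to the vectors $p_k$ and $FE^Tq_k$ and to the scalars $\alpha_k$ and $\beta_k$ in the CP-Lanczos Process.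
   Context: Setting: $A \in \mathbb{R}^{n\times n}$ is symmetric, $B \in \mathbb{R}^{m\times n}$, $C \in \mathbb{R}^{m\times m}$ is nonzero and symmetric, $b \in \mathbb{R}^n$, and $K = \begin{bmatrix} A & B^T \\ B & -C\end{bmatrix}$ is nonsingular ($B$ need not have full rank and $C$ need not be semi-definite). The matrix $G \in \mathbb{R}^{n\times n}$ is such that $P = \begin{bmatrix} G & B^T \\ B & -C\end{bmatrix}$ is nonsingular. $[u\,;\,v]$ denotes the column vector obtained by stacking $u$ over $v$. Projected Lanczos Process (two-part vectors $v_k = [v_{k,x}\,;\,v_{k,w}] \in \mathbb{R}^{n}\times\mathbb{R}^p$). Call "projection of $[u_x\,;\,u_w]$" the solution $[\bar u_x\,;\,\bar u_w\,;\,\bar z]$ of $$\begin{bmatrix} G & 0 & B^T \\ 0 & F^{-1} & E^T \\ B & E & 0\end{bmatrix}\begin{bmatrix}\bar u_x\\ \bar u_w\\ \bar z\end{bmatrix} = \begin{bmatrix} u_x\\ u_w\\ 0\end{bmatrix}.$$ Choose $[x_0\,;\,w_0]$ with $Bx_0+Ew_0=0$. Set $v_{0,x}=0$, $v_{0,w}=-w_0$, $u_{0,x}=b-Ax_0$, $u_{0,w}=-F^{-1}w_0$. Let $[\bar u_{1,x}\,;\,\bar u_{1,w}\,;\,\bar z_1]$ be the projection of $[u_{0,x}\,;\,u_{0,w}]$. Set $v_{1,x}=\bar u_{1,x}$, $v_{1,w}=\bar u_{1,w}$, $\beta_1=(v_{1,x}^Tu_{0,x}+v_{1,w}^Tu_{0,w})^{1/2}$;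 if $\beta_1\neq0$, divide $v_{1,x}$ and $v_{1,w}$ by $\beta_1$. For $k=1,2,\dots$, while $\beta_k\ne0$: set $u_{k,x}=Av_{k,x}$, $u_{k,w}=F^{-1}v_{k,w}$; $\alpha_k=v_{k,x}^Tu_{k,x}+v_{k,w}^Tu_{k,w}$; let $[\bar u_{k+1,x}\,;\,\bar u_{k+1,w}\,;\,\bar z_{k+1}]$ be the projection of $[u_{k,x}\,;\,u_{k,w}]$; set $v_{k+1,x}=\bar u_{k+1,x}-\alpha_kv_{k,x}-\beta_kv_{k-1,x}$, $v_{k+1,w}=\bar u_{k+1,w}-\alpha_kv_{k,w}-\beta_kv_{k-1,w}$; $\beta_{k+1}=(v_{k+1,x}^Tu_{k,x}+v_{k+1,w}^Tu_{k,w})^{1/2}$; if $\beta_{k+1}\ne0$, divide $v_{k+1,x}$ and $v_{k+1,w}$ by $\beta_{k+1}$. CP-Lanczos Process. Choose $[x_0\,;\,q_0]$ with $Bx_0-Cq_0=0$. Set $p_0=0$, $u_0=b-Ax_0$, $t_0=Cq_0$. Let $[\bar p_1\,;\,\bar z_1]$ solve $P[\bar p_1\,;\,\bar z_1]=[u_0\,;\,-t_0]$. Set $p_1=\bar p_1$, $s_1 = q_0-\bar z_1$, $q_1=s_1$, $\beta_1=(p_1^Tu_0+q_1^Tt_0)^{1/2}$; if $\beta_1\ne0$, divide $p_1$ and $q_1$ by $\beta_1$. For $k=1,2,\dots$, while $\beta_k\ne0$: set $u_k=Ap_k$, $t_k=Cq_k$, $\alpha_k=p_k^Tu_k+q_k^Tt_k$;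 let $[\bar p_{k+1}\,;\,\bar z_{k+1}]$ solve $P[\bar p_{k+1}\,;\,\bar z_{k+1}]=[u_k\,;\,-t_k]$; set $p_{k+1}=\bar p_{k+1}-\alpha_kp_k-\beta_kp_{k-1}$, $s_{k+1}=q_k-\bar z_{k+1}$, $q_{k+1}=s_{k+1}-\alpha_kq_k-\beta_kq_{k-1}$; $\beta_{k+1}=(p_{k+1}^Tu_k+q_{k+1}^Tt_k)^{1/2}$; if $\beta_{k+1}\ne0$, divide $p_{k+1}$ and $q_{k+1}$ by $\beta_{k+1}$. In both processes, $v_{k,x},v_{k,w},p_k,q_k$ denote, for $k\ge1$, the vectors after normalization. "Equivalent" means that the quantities generated by the two processes correspond to each other as listed in the claim. *)

theory Defs
  imports "HOL-Analysis.Analysis"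
begin

text \<open>Block vectors and matrices are indexed by sum types: the index \<open>Inl i\<close> addresses
  the first block and \<open>Inr i\<close> the second one.\<close>

definition stack :: "real^'a \<Rightarrow> real^'b \<Rightarrow> real^('a + 'b)" where
  "stack u v = (\<chi> i. case i of Inl a \<Rightarrow> u $ a | Inr b \<Rightarrow> v $ b)"

definition block_row :: "real^'a^'c \<Rightarrow> real^'b^'c \<Rightarrow> real^('a + 'b)^'c" where
  "block_row X Y = (\<chi> i. stack (X $ i) (Y $ i))"

definition block_matrix ::
  "real^'a^'c \<Rightarrow> real^'b^'c \<Rightarrow> real^'a^'d \<Rightarrow> real^'b^'d \<Rightarrow> real^('a + 'b)^('c + 'd)" where
  "block_matrix X Y Z W =
     (\<chi> i. case i of Inl c \<Rightarrow> stack (X $ c) (Y $ c) | Inr d \<Rightarrow> stack (Z $ d) (W $ d))"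

definition pos_def_on_null :: "real^'a^'a \<Rightarrow> real^'a^'m \<Rightarrow> bool" where
  "pos_def_on_null H N \<longleftrightarrow> (\<forall>v. N *v v = 0 \<and> v \<noteq> 0 \<longrightarrow> v \<bullet> (H *v v) > 0)"

definition normalise :: "real \<Rightarrow> real^'a \<Rightarrow> real^'a" where
  "normalise c v = (if c \<noteq> 0 then v /\<^sub>R c else v)"

definition projection_matrix ::
  "real^'n^'n \<Rightarrow> real^'n^'m \<Rightarrow> real^'p^'m \<Rightarrow> real^'p^'p \<Rightarrow> real^(('n + 'p) + 'm)^(('n + 'p) + 'm)" where
  "projection_matrix G B E F =
     block_matrix (block_matrix G 0 0 (matrix_inv F)) (transpose (block_row B E)) (block_row B E) 0"

text \<open>
  The following two predicates say that the given sequences record a run of the respective process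
  in which the vectors and the scalars \<open>\<beta>\<close> with index at most \<open>K\<close> have been generated.
  The index \<open>k\<close> describes the passage from \<open>k\<close> to \<open>k + 1\<close>. The unnormalised vectors are
  \<open>yx\<close>, \<open>yw\<close> (respectively \<open>yp\<close>, \<open>yq\<close>), while \<open>vx\<close>, \<open>vw\<close>, \<open>p\<close>, \<open>q\<close> are normalised.
  For \<open>k \<ge> 1\<close> the passage requires \<open>\<beta> k \<noteq> 0\<close>; \<open>\<alpha> k\<close> is generated for
  \<open>1 \<le> k \<le> K\<close> with \<open>\<beta> k \<noteq> 0\<close>. Since the \<open>\<beta>\<close> are real square roots (whereas
  \<^const>\<open>sqrt\<close> is an odd function on all reals), a run also stops before a step that has a
  negative radicand. Entries of the sequences that have not been generated are unconstrained.
\<close>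

definition projected_lanczos_run ::
  "real^'n^'n \<Rightarrow> real^'n^'m \<Rightarrow> real^'p^'m \<Rightarrow> real^'p^'p \<Rightarrow> real^'n^'n \<Rightarrow> real^'n \<Rightarrow>
   real^'n \<Rightarrow> real^'p \<Rightarrow> nat \<Rightarrow>
   (nat \<Rightarrow> real^'n) \<Rightarrow> (nat \<Rightarrow> real^'p) \<Rightarrow> (nat \<Rightarrow> real) \<Rightarrow> (nat \<Rightarrow> real) \<Rightarrow> bool" where
  "projected_lanczos_run A B E F G b x0 w0 K vx vw \<alpha> \<beta> \<longleftrightarrow>
    (\<exists>ux uw ubarx ubarw zbar yx yw.
       B *v x0 + E *v w0 = 0 \<and>
       vx 0 = 0 \<and> vw 0 = - w0 \<and> ux 0 = b - A *v x0 \<and> uw 0 = - (matrix_inv F *v w0) \<and>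
       (\<forall>k<K.
          (1 \<le> k \<longrightarrow> \<beta> k \<noteq> 0) \<and>
          projection_matrix G B E F *v
            stack (stack (ubarx (Suc k)) (ubarw (Suc k))) (zbar (Suc k))
            = stack (stack (ux k) (uw k)) 0 \<and>
          yx (Suc k) =
            (if k = 0 then ubarx (Suc k)
             else ubarx (Suc k) - \<alpha> k *\<^sub>R vx k - \<beta> k *\<^sub>R vx (k - 1)) \<and>
          yw (Suc k) =
            (if k = 0 then ubarw (Suc k)
             else ubarw (Suc k) - \<alpha> k *\<^sub>R vw k - \<beta> k *\<^sub>R vw (k - 1)) \<and>
          0 \<le> yx (Suc k) \<bullet> ux k + yw (Suc k) \<bullet> uw k \<and>
          \<beta> (Suc k) = sqrt (yx (Suc k) \<bullet> ux k + yw (Suc k) \<bullet> uw k) \<and>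
          vx (Suc k) = normalise (\<beta> (Suc k)) (yx (Suc k)) \<and>
          vw (Suc k) = normalise (\<beta> (Suc k)) (yw (Suc k))) \<and>
       (\<forall>k. 1 \<le> k \<and> k \<le> K \<and> \<beta> k \<noteq> 0 \<longrightarrow>
          ux k = A *v vx k \<and> uw k = matrix_inv F *v vw k \<and>
          \<alpha> k = vx k \<bullet> ux k + vw k \<bullet> uw k))"

definition cp_lanczos_run ::
  "real^'n^'n \<Rightarrow> real^'n^'m \<Rightarrow> real^'m^'m \<Rightarrow> real^'n^'n \<Rightarrow> real^'n \<Rightarrow>
   real^'n \<Rightarrow> real^'m \<Rightarrow> nat \<Rightarrow>
   (nat \<Rightarrow> real^'n) \<Rightarrow> (nat \<Rightarrow> real^'m) \<Rightarrow> (nat \<Rightarrow> real) \<Rightarrow> (nat \<Rightarrow> real) \<Rightarrow> bool" where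
  "cp_lanczos_run A B C G b x0 q0 K p q \<alpha> \<beta> \<longleftrightarrow>
    (\<exists>u t pbar zbar s yp yq.
       B *v x0 - C *v q0 = 0 \<and>
       p 0 = 0 \<and> q 0 = q0 \<and> u 0 = b - A *v x0 \<and> t 0 = C *v q0 \<and>
       (\<forall>k<K.
          (1 \<le> k \<longrightarrow> \<beta> k \<noteq> 0) \<and>
          block_matrix G (transpose B) B (- C) *v stack (pbar (Suc k)) (zbar (Suc k))
            = stack (u k) (- t k) \<and>
          yp (Suc k) =
            (if k = 0 then pbar (Suc k)
             else pbar (Suc k) - \<alpha> k *\<^sub>R p k - \<beta> k *\<^sub>R p (k - 1)) \<and>
          s (Suc k) = q k - zbar (Suc k) \<and>
          yq (Suc k) =
            (if k = 0 then s (Suc k)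
             else s (Suc k) - \<alpha> k *\<^sub>R q k - \<beta> k *\<^sub>R q (k - 1)) \<and>
          0 \<le> yp (Suc k) \<bullet> u k + yq (Suc k) \<bullet> t k \<and>
          \<beta> (Suc k) = sqrt (yp (Suc k) \<bullet> u k + yq (Suc k) \<bullet> t k) \<and>
          p (Suc k) = normalise (\<beta> (Suc k)) (yp (Suc k)) \<and>
          q (Suc k) = normalise (\<beta> (Suc k)) (yq (Suc k))) \<and>
       (\<forall>k. 1 \<le> k \<and> k \<le> K \<and> \<beta> k \<noteq> 0 \<longrightarrow>
          u k = A *v p k \<and> t k = C *v q k \<and>
          \<alpha> k = p k \<bullet> u k + q k \<bullet> t k))"

end

theory Submission
  imports Defs
begin

text \<open>Eliminating the second block of the projection through
  \<open>u\<^sub>w = F E\<^sup>T (q - z)\<close> turns the projection of \<open>[u\<^sub>x ; E\<^sup>T q]\<close> into the system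
  \<open>P [p ; z] = [u\<^sub>x ; - C q]\<close> with the same multiplier \<open>z\<close>, and
  \<open>(F E\<^sup>T y) \<bullet> (E\<^sup>T q) = y \<bullet> (C q)\<close>. Hence a run of the CP process is mapped to a run of
  the projected process by \<open>v\<^sub>w = F E\<^sup>T q\<close>. Conversely, the multipliers \<open>z\<close> of a projected run
  determine vectors \<open>q\<close> that complete it to a CP run. Since \<open>P\<close> is nonsingular, CP runs are
  unique, so every CP run arises in this way.\<close>

text \<open>As a simp rule this would turn \<open>transpose E *v q\<close> into
  \<open>q v* E\<close>, and the block identities below, stated with \<open>transpose\<close>, would
  no longer match.\<close>

declare transpose_matrix_vector [simp del]

section \<open>Arithmetic of block vectors and matrices\<close>

lemma stack_eq_iff [simp]: "stack u v = stack u' v' \<longleftrightarrow> u = u' \<and> v = v'"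
proof
  assume eq: "stack u v = stack u' v'"
  have "u $ a = u' $ a" for a
    using arg_cong[OF eq, of "\<lambda>x. x $ Inl a"] by (simp add: stack_def)
  moreover have "v $ c = v' $ c" for c
    using arg_cong[OF eq, of "\<lambda>x. x $ Inr c"] by (simp add: stack_def)
  ultimately show "u = u' \<and> v = v'" by (simp add: vec_eq_iff)
qed simp

lemma sum_UNIV_Plus:
  fixes f :: "'a::finite + 'b::finite \<Rightarrow> 'c::comm_monoid_add"
  shows "sum f UNIV = (\<Sum>a\<in>UNIV. f (Inl a)) + (\<Sum>b\<in>UNIV. f (Inr b))"
  by (simp add: UNIV_Plus_UNIV[symmetric] sum.Plus del: UNIV_Plus_UNIV)

lemma block_row_mult_stack:
  "block_row X Y *v stack u v = X *v u + Y *v v"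
  by (simp add: vec_eq_iff matrix_vector_mult_def block_row_def stack_def sum_UNIV_Plus)

lemma transpose_block_row_mult:
  "transpose (block_row X Y) *v z = stack (transpose X *v z) (transpose Y *v z)"
  by (auto simp: vec_eq_iff matrix_vector_mult_def block_row_def stack_def transpose_def
      split: sum.split)

lemma block_matrix_mult_stack:
  "block_matrix X Y Z W *v stack u v = stack (X *v u + Y *v v) (Z *v u + W *v v)"
  by (auto simp: vec_eq_iff matrix_vector_mult_def block_matrix_def stack_def sum_UNIV_Plus
      split: sum.split)

lemma stack_add: "stack u v + stack u' v' = stack (u + u') (v + v')"
  by (auto simp: vec_eq_iff stack_def split: sum.split)

lemma uminus_matrix_vector_mult: "(- X) *v v = - (X *v v)" for X :: "real^'a^'b"
  by (simp add: vec_eq_iff matrix_vector_mult_def sum_negf)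

lemma matrix_vector_mult_uminus: "X *v (- v) = - (X *v v)" for X :: "real^'a^'b"
  by (simp add: vec_eq_iff matrix_vector_mult_def sum_negf)

lemma matrix_inv_mult_vector:
  fixes F :: "real^'p^'p"
  assumes "invertible F"
  shows "matrix_inv F *v (F *v v) = v" "F *v (matrix_inv F *v v) = v"
proof -
  \<comment> \<open>\<open>matrix_inv\<close> is a choice of a two-sided inverse, so both identities
    follow from the existence of one.\<close>
  have "F ** matrix_inv F = mat 1 \<and> matrix_inv F ** F = mat 1"
    using assms unfolding invertible_def matrix_inv_def by (rule someI_ex)
  then show "matrix_inv F *v (F *v v) = v" "F *v (matrix_inv F *v v) = v"
    by (simp_all add: matrix_vector_mul_assoc)
qed

lemma normalise_matrix_vector_mult: "normalise c (X *v v) = X *v normalise c v"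
  by (simp add: normalise_def matrix_vector_mult_scaleR)

section \<open>Eliminating the second block\<close>

text \<open>The second block row reads \<open>matrix_inv F *v w = transpose E *v (q - z)\<close> and
  can be solved for \<open>w\<close>. Inserting this \<open>w\<close> into the constraint row
  produces the second row of the system with \<open>P\<close>; the first rows agree already. The
  right-hand side is taken in the range of \<open>transpose E\<close> because this is the form that
  occurs at every step of a projected run.\<close>

lemma projection_matrix_mult_eq_iff:
  fixes B :: "real^'n^'m" and E :: "real^'p^'m" and F :: "real^'p^'p"
  assumes "invertible F"
  shows "projection_matrix G B E F *v stack (stack x w) z = stack (stack a (transpose E *v q)) 0
     \<longleftrightarrow> w = F *v (transpose E *v (q - z)) \<and>
       block_matrix G (transpose B) B (- (E ** F ** transpose E)) *v stack x z
         = stack a (- ((E ** F ** transpose E) *v q))"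
proof -
  have "matrix_inv F *v w + transpose E *v z = transpose E *v q \<longleftrightarrow>
      matrix_inv F *v w = transpose E *v (q - z)"
    by (auto simp: matrix_vector_mult_diff_distrib algebra_simps)
  also have "\<dots> \<longleftrightarrow> w = F *v (transpose E *v (q - z))"
    using matrix_inv_mult_vector[OF assms] by metis
  finally have w: "matrix_inv F *v w + transpose E *v z = transpose E *v q \<longleftrightarrow>
      w = F *v (transpose E *v (q - z))" .
  have "B *v x + E *v w = 0 \<longleftrightarrow>
      B *v x + (- (E ** F ** transpose E)) *v z = - ((E ** F ** transpose E) *v q)"
    if "w = F *v (transpose E *v (q - z))"
    unfolding that
    by (auto simp: uminus_matrix_vector_mult matrix_vector_mult_diff_distrib algebra_simps
        matrix_vector_mul_assoc[symmetric] eq_neg_iff_add_eq_0)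
  then show ?thesis
    using w
    by (auto simp: projection_matrix_def block_matrix_mult_stack block_row_mult_stack
        transpose_block_row_mult stack_add)
qed

text \<open>Moves \<open>E\<close> and then the symmetric \<open>F\<close> to the other side of the
  inner product. It makes the radicands and the \<alpha> of the two processes coincide.\<close>

lemma inner_factorised:
  fixes E :: "real^'p^'m" and F :: "real^'p^'p"
  assumes "transpose F = F"
  shows "(F *v (transpose E *v y)) \<bullet> (transpose E *v q) = y \<bullet> ((E ** F ** transpose E) *v q)"
proof -
  have "y \<bullet> ((E ** F ** transpose E) *v q) = (transpose E *v y) \<bullet> (F *v (transpose E *v q))"
    by (simp add: matrix_vector_mul_assoc[symmetric] dot_lmul_matrix[symmetric]
        transpose_matrix_vector)
  also have "\<dots> = (transpose F *v (transpose E *v y)) \<bullet> (transpose E *v q)"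
    by (simp add: dot_lmul_matrix transpose_matrix_vector)
  finally show ?thesis using assms by simp
qed

section \<open>Access to the auxiliary sequences of a run\<close>

lemma cp_lanczos_runE:
  assumes "cp_lanczos_run A B C G b x0 q0 K p q \<alpha> \<beta>"
  obtains u t pbar zbar s yp yq where
    "B *v x0 - C *v q0 = 0" and "p 0 = 0" and "q 0 = q0" and "u 0 = b - A *v x0" and "t 0 = C *v q0"
    and "\<And>k. k < K \<Longrightarrow>
          (1 \<le> k \<longrightarrow> \<beta> k \<noteq> 0) \<and>
          block_matrix G (transpose B) B (- C) *v stack (pbar (Suc k)) (zbar (Suc k))
            = stack (u k) (- t k) \<and>
          yp (Suc k) =
            (if k = 0 then pbar (Suc k)
             else pbar (Suc k) - \<alpha> k *\<^sub>R p k - \<beta> k *\<^sub>R p (k - 1)) \<and>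
          s (Suc k) = q k - zbar (Suc k) \<and>
          yq (Suc k) =
            (if k = 0 then s (Suc k)
             else s (Suc k) - \<alpha> k *\<^sub>R q k - \<beta> k *\<^sub>R q (k - 1)) \<and>
          0 \<le> yp (Suc k) \<bullet> u k + yq (Suc k) \<bullet> t k \<and>
          \<beta> (Suc k) = sqrt (yp (Suc k) \<bullet> u k + yq (Suc k) \<bullet> t k) \<and>
          p (Suc k) = normalise (\<beta> (Suc k)) (yp (Suc k)) \<and>
          q (Suc k) = normalise (\<beta> (Suc k)) (yq (Suc k))"
    and "\<And>k. 1 \<le> k \<Longrightarrow> k \<le> K \<Longrightarrow> \<beta> k \<noteq> 0 \<Longrightarrow>
          u k = A *v p k \<and> t k = C *v q k \<and> \<alpha> k = p k \<bullet> u k + q k \<bullet> t k"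
  using assms unfolding cp_lanczos_run_def
proof (elim exE conjE, goal_cases)
  case (1 u t pbar zbar s yp yq)
  show thesis
    \<comment> \<open>The arguments of \<open>of\<close> follow the order of first occurrence in the
      rule, where \<open>yp\<close> precedes \<open>s\<close>.\<close>
    by (rule that[of u t pbar zbar yp s yq]) (use 1 in blast)+
qed

lemma projected_lanczos_runE:
  assumes "projected_lanczos_run A B E F G b x0 w0 K vx vw \<alpha> \<beta>"
  obtains ux uw ubarx ubarw zbar yx yw where
    "B *v x0 + E *v w0 = 0" and "vx 0 = 0" and "vw 0 = - w0" and "ux 0 = b - A *v x0"
    and "uw 0 = - (matrix_inv F *v w0)"
    and "\<And>k. k < K \<Longrightarrow>
          (1 \<le> k \<longrightarrow> \<beta> k \<noteq> 0) \<and>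
          projection_matrix G B E F *v
            stack (stack (ubarx (Suc k)) (ubarw (Suc k))) (zbar (Suc k))
            = stack (stack (ux k) (uw k)) 0 \<and>
          yx (Suc k) =
            (if k = 0 then ubarx (Suc k)
             else ubarx (Suc k) - \<alpha> k *\<^sub>R vx k - \<beta> k *\<^sub>R vx (k - 1)) \<and>
          yw (Suc k) =
            (if k = 0 then ubarw (Suc k)
             else ubarw (Suc k) - \<alpha> k *\<^sub>R vw k - \<beta> k *\<^sub>R vw (k - 1)) \<and>
          0 \<le> yx (Suc k) \<bullet> ux k + yw (Suc k) \<bullet> uw k \<and>
          \<beta> (Suc k) = sqrt (yx (Suc k) \<bullet> ux k + yw (Suc k) \<bullet> uw k) \<and>
          vx (Suc k) = normalise (\<beta> (Suc k)) (yx (Suc k)) \<and>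
          vw (Suc k) = normalise (\<beta> (Suc k)) (yw (Suc k))"
    and "\<And>k. 1 \<le> k \<Longrightarrow> k \<le> K \<Longrightarrow> \<beta> k \<noteq> 0 \<Longrightarrow>
          ux k = A *v vx k \<and> uw k = matrix_inv F *v vw k \<and>
          \<alpha> k = vx k \<bullet> ux k + vw k \<bullet> uw k"
  using assms unfolding projected_lanczos_run_def
proof (elim exE conjE, goal_cases)
  case (1 ux uw ubarx ubarw zbar yx yw)
  show thesis
    by (rule that[of ux uw ubarx ubarw zbar yx yw]) (use 1 in blast)+
qed

section \<open>Translating runs in both directions\<close>

lemma cp_lanczos_run_imp_projected:
  fixes E :: "real^'p^'m" and F :: "real^'p^'p"
  assumes F: "invertible F" "transpose F = F"
    and run: "cp_lanczos_run A B (E ** F ** transpose E) G b x0 q0 K p q \<alpha> \<beta>"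
  shows "projected_lanczos_run A B E F G b x0 (- (F *v (transpose E *v q0))) K
    p (\<lambda>k. F *v (transpose E *v q k)) \<alpha> \<beta>"
proof -
  let ?C = "E ** F ** transpose E"
  let ?L = "\<lambda>v. F *v (transpose E *v v)"
  from run obtain u t pbar zbar s yp yq where
    init: "B *v x0 - ?C *v q0 = 0" "p 0 = 0" "q 0 = q0" "u 0 = b - A *v x0" "t 0 = ?C *v q0"
    and step: "\<And>k. k < K \<Longrightarrow>
          (1 \<le> k \<longrightarrow> \<beta> k \<noteq> 0) \<and>
          block_matrix G (transpose B) B (- ?C) *v stack (pbar (Suc k)) (zbar (Suc k))
            = stack (u k) (- t k) \<and>
          yp (Suc k) =
            (if k = 0 then pbar (Suc k)
             else pbar (Suc k) - \<alpha> k *\<^sub>R p k - \<beta> k *\<^sub>R p (k - 1)) \<and>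
          s (Suc k) = q k - zbar (Suc k) \<and>
          yq (Suc k) =
            (if k = 0 then s (Suc k)
             else s (Suc k) - \<alpha> k *\<^sub>R q k - \<beta> k *\<^sub>R q (k - 1)) \<and>
          0 \<le> yp (Suc k) \<bullet> u k + yq (Suc k) \<bullet> t k \<and>
          \<beta> (Suc k) = sqrt (yp (Suc k) \<bullet> u k + yq (Suc k) \<bullet> t k) \<and>
          p (Suc k) = normalise (\<beta> (Suc k)) (yp (Suc k)) \<and>
          q (Suc k) = normalise (\<beta> (Suc k)) (yq (Suc k))"
    and next_rhs: "\<And>k. 1 \<le> k \<Longrightarrow> k \<le> K \<Longrightarrow> \<beta> k \<noteq> 0 \<Longrightarrow>
          u k = A *v p k \<and> t k = ?C *v q k \<and> \<alpha> k = p k \<bullet> u k + q k \<bullet> t k"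
    by (rule cp_lanczos_runE) blast
  \<comment> \<open>For \<open>k = 0\<close> this is the initialisation; for larger \<open>k\<close>
    the fact that step \<open>k\<close> is taken gives \<open>\<beta> k \<noteq> 0\<close>, so
    \<open>t k\<close> has been generated. At \<open>k = K\<close> it could fail, since
    \<open>\<beta> K\<close> may vanish.\<close>
  have t: "t k = ?C *v q k" if "k < K" for k
    using init next_rhs[of k] step[OF that] that by (cases k) auto
  show ?thesis
    unfolding projected_lanczos_run_def
  \<comment> \<open>The witness for \<open>uw\<close> is \<open>transpose E *v q k\<close>, which
    equals \<open>matrix_inv F *v vw k\<close> when \<open>vw k = ?L (q k)\<close>. The remaining
    second-block sequences are images under \<open>?L\<close>, and the multipliers
    \<open>zbar\<close> are kept.\<close>
  proof (rule exI[of _ u], rule exI[of _ "\<lambda>k. transpose E *v q k"], rule exI[of _ pbar],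
      rule exI[of _ "\<lambda>k. ?L (s k)"], rule exI[of _ zbar], rule exI[of _ yp],
      rule exI[of _ "\<lambda>k. ?L (yq k)"], intro conjI allI impI)
    show "B *v x0 + E *v (- ?L q0) = 0"
      using init(1) by (simp add: matrix_vector_mult_uminus matrix_vector_mul_assoc matrix_mul_assoc)
    \<comment> \<open>The minus sign in the choice of \<open>w0\<close> cancels the one in the
      initial \<open>uw\<close>, so index 0 obeys the same formula as the later ones.\<close>
    show "transpose E *v q 0 = - (matrix_inv F *v - ?L q0)"
      by (simp add: init matrix_vector_mult_uminus matrix_inv_mult_vector[OF F(1)])
  next
    fix k assume k: "k < K"
    note st = step[OF k] t[OF k]
    have radicand: "yp (Suc k) \<bullet> u k + ?L (yq (Suc k)) \<bullet> (transpose E *v q k)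
        = yp (Suc k) \<bullet> u k + yq (Suc k) \<bullet> t k"
      by (simp only: inner_factorised[OF F(2)] t[OF k])
    show "0 \<le> yp (Suc k) \<bullet> u k + ?L (yq (Suc k)) \<bullet> (transpose E *v q k)"
      "\<beta> (Suc k) = sqrt (yp (Suc k) \<bullet> u k + ?L (yq (Suc k)) \<bullet> (transpose E *v q k))"
      unfolding radicand using step[OF k] by blast+
    show "projection_matrix G B E F *v stack (stack (pbar (Suc k)) (?L (s (Suc k)))) (zbar (Suc k))
        = stack (stack (u k) (transpose E *v q k)) 0"
      using st by (simp add: projection_matrix_mult_eq_iff[OF F(1)])
    show "?L (yq (Suc k)) = (if k = 0 then ?L (s (Suc k))
        else ?L (s (Suc k)) - \<alpha> k *\<^sub>R ?L (q k) - \<beta> k *\<^sub>R ?L (q (k - 1)))"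
      using st by (simp add: matrix_vector_mult_diff_distrib matrix_vector_mult_scaleR)
    show "?L (q (Suc k)) = normalise (\<beta> (Suc k)) (?L (yq (Suc k)))"
      using st by (simp add: normalise_matrix_vector_mult)
  qed (use step t next_rhs init in
      \<open>auto simp: inner_factorised[OF F(2)] matrix_inv_mult_vector[OF F(1)]\<close>)
qed

text \<open>The recurrence for \<open>q\<close> in the CP process with \<open>s\<close> and the
  unnormalised vectors substituted, driven by given multipliers and scalars. The multipliers are
  needed because the map from \<open>q\<close> to \<open>F *v (transpose E *v q)\<close> may have a
  kernel, so \<open>q\<close> cannot in general be read off from \<open>vw\<close>.\<close>

fun cp_dual_vector ::
  "real^'m \<Rightarrow> (nat \<Rightarrow> real^'m) \<Rightarrow> (nat \<Rightarrow> real) \<Rightarrow> (nat \<Rightarrow> real) \<Rightarrow> nat \<Rightarrow> real^'m" where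
  "cp_dual_vector q0 z \<alpha> \<beta> 0 = q0"
| "cp_dual_vector q0 z \<alpha> \<beta> (Suc k) = normalise (\<beta> (Suc k))
     (if k = 0 then q0 - z 1
      else cp_dual_vector q0 z \<alpha> \<beta> k - z (Suc k) - \<alpha> k *\<^sub>R cp_dual_vector q0 z \<alpha> \<beta> k
        - \<beta> k *\<^sub>R cp_dual_vector q0 z \<alpha> \<beta> (k - 1))"

text \<open>The first-block vectors and both scalar sequences are reused unchanged; only
  \<open>q\<close> has to be built, by feeding the multipliers of the projected run into
  \<open>cp_dual_vector\<close>. Linearity of the recurrence then carries
  \<open>vw k = F *v (transpose E *v q k)\<close> from step to step.\<close>

lemma projected_lanczos_run_imp_cp:
  fixes E :: "real^'p^'m" and F :: "real^'p^'p"
  assumes F: "invertible F" "transpose F = F"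
    and run: "projected_lanczos_run A B E F G b x0 (- (F *v (transpose E *v q0))) K vx vw \<alpha> \<beta>"
  obtains q where "cp_lanczos_run A B (E ** F ** transpose E) G b x0 q0 K vx q \<alpha> \<beta>"
    and "\<And>k. k \<le> K \<Longrightarrow> vw k = F *v (transpose E *v q k)"
proof -
  let ?C = "E ** F ** transpose E"
  let ?L = "\<lambda>v. F *v (transpose E *v v)"
  let ?w0 = "- ?L q0"
  from run obtain ux uw ubarx ubarw zbar yx yw where
    init: "B *v x0 + E *v ?w0 = 0" "vx 0 = 0" "vw 0 = - ?w0" "ux 0 = b - A *v x0"
      "uw 0 = - (matrix_inv F *v ?w0)"
    and step: "\<And>k. k < K \<Longrightarrow>
          (1 \<le> k \<longrightarrow> \<beta> k \<noteq> 0) \<and>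
          projection_matrix G B E F *v
            stack (stack (ubarx (Suc k)) (ubarw (Suc k))) (zbar (Suc k))
            = stack (stack (ux k) (uw k)) 0 \<and>
          yx (Suc k) =
            (if k = 0 then ubarx (Suc k)
             else ubarx (Suc k) - \<alpha> k *\<^sub>R vx k - \<beta> k *\<^sub>R vx (k - 1)) \<and>
          yw (Suc k) =
            (if k = 0 then ubarw (Suc k)
             else ubarw (Suc k) - \<alpha> k *\<^sub>R vw k - \<beta> k *\<^sub>R vw (k - 1)) \<and>
          0 \<le> yx (Suc k) \<bullet> ux k + yw (Suc k) \<bullet> uw k \<and>
          \<beta> (Suc k) = sqrt (yx (Suc k) \<bullet> ux k + yw (Suc k) \<bullet> uw k) \<and>
          vx (Suc k) = normalise (\<beta> (Suc k)) (yx (Suc k)) \<and>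
          vw (Suc k) = normalise (\<beta> (Suc k)) (yw (Suc k))"
    and next_rhs: "\<And>k. 1 \<le> k \<Longrightarrow> k \<le> K \<Longrightarrow> \<beta> k \<noteq> 0 \<Longrightarrow>
          ux k = A *v vx k \<and> uw k = matrix_inv F *v vw k \<and>
          \<alpha> k = vx k \<bullet> ux k + vw k \<bullet> uw k"
  by (rule projected_lanczos_runE) blast
  define q where "q = cp_dual_vector q0 zbar \<alpha> \<beta>"
  \<comment> \<open>Here and in \<open>yq\<close> the index is that of the new vector, so 1 marks
    the initial step. The values at 0 are arbitrary: a run constrains these sequences at successors
    only.\<close>
  define s where "s = (\<lambda>k. q (k - 1) - zbar k)"
  define yq where "yq = (\<lambda>j. if j = 1 then s j
    else s j - \<alpha> (j - 1) *\<^sub>R q (j - 1) - \<beta> (j - 1) *\<^sub>R q (j - 2))"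
  have q0: "q 0 = q0" by (simp add: q_def)
  have q_Suc: "q (Suc k) = normalise (\<beta> (Suc k)) (yq (Suc k))" for k
    by (simp add: q_def yq_def s_def numeral_2_eq_2)
  \<comment> \<open>The relation between \<open>vw\<close> and \<open>q\<close> is a premise of this
    fact and of the next two because they serve in the induction that proves it.\<close>
  have uw: "uw k = transpose E *v q k" if "k < K" "vw k = ?L (q k)" for k
    using init next_rhs[of k] step[OF that(1)] that
    by (cases k) (auto simp: q0 matrix_vector_mult_uminus matrix_inv_mult_vector[OF F(1)])
  have system: "ubarw (Suc k) = ?L (s (Suc k)) \<and>
      block_matrix G (transpose B) B (- ?C) *v stack (ubarx (Suc k)) (zbar (Suc k))
        = stack (ux k) (- (?C *v q k))" if "k < K" "vw k = ?L (q k)" for k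
    using step[OF that(1)] uw[OF that]
    by (simp add: projection_matrix_mult_eq_iff[OF F(1)] s_def)
  have yw_vec: "yw (Suc k) = ?L (yq (Suc k))"
    if "k < K" "vw k = ?L (q k)" "vw (k - 1) = ?L (q (k - 1))" for k
    using step[OF that(1)] system[OF that(1,2)] that
    by (cases "k = 0")
      (simp_all add: yq_def numeral_2_eq_2 matrix_vector_mult_diff_distrib matrix_vector_mult_scaleR)
  have vw: "vw k = ?L (q k)" if "k \<le> K" for k
    using that
  \<comment> \<open>Strong induction, since the three-term recurrence refers to the two preceding
    vectors.\<close>
  proof (induction k rule: less_induct)
    case (less k)
    show ?case
    proof (cases k)
      case 0
      then show ?thesis using init by (simp add: q0)
    next
      case (Suc j)
      then show ?thesis
        using yw_vec[of j] less step[of j] by (simp add: q_Suc normalise_matrix_vector_mult)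
    qed
  qed
  have inner: "yw (Suc k) \<bullet> uw k = yq (Suc k) \<bullet> (?C *v q k)" if "k < K" for k
    using yw_vec[of k] uw[of k] vw[of k] vw[of "k - 1"] that
    by (simp add: inner_factorised[OF F(2)])
  have "cp_lanczos_run A B ?C G b x0 q0 K vx q \<alpha> \<beta>"
    unfolding cp_lanczos_run_def
  proof (rule exI[of _ ux], rule exI[of _ "\<lambda>k. ?C *v q k"], rule exI[of _ ubarx],
      rule exI[of _ zbar], rule exI[of _ s], rule exI[of _ yx], rule exI[of _ yq],
      intro conjI allI impI)
    show "B *v x0 - ?C *v q0 = 0"
      using init(1) by (simp add: matrix_vector_mult_uminus matrix_vector_mul_assoc matrix_mul_assoc)
  next
    fix k assume "1 \<le> k \<and> k \<le> K \<and> \<beta> k \<noteq> 0"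
    then show "\<alpha> k = vx k \<bullet> ux k + q k \<bullet> (?C *v q k)"
      using next_rhs[of k] vw[of k]
      by (simp add: matrix_inv_mult_vector[OF F(1)] inner_factorised[OF F(2)])
  next
    fix k assume k: "k < K"
    show "0 \<le> yx (Suc k) \<bullet> ux k + yq (Suc k) \<bullet> (?C *v q k)"
      "\<beta> (Suc k) = sqrt (yx (Suc k) \<bullet> ux k + yq (Suc k) \<bullet> (?C *v q k))"
      unfolding inner[OF k, symmetric] using step[OF k] by blast+
    show "yq (Suc k) = (if k = 0 then s (Suc k)
        else s (Suc k) - \<alpha> k *\<^sub>R q k - \<beta> k *\<^sub>R q (k - 1))"
      by (simp add: yq_def numeral_2_eq_2)
  qed (use step system vw next_rhs init in \<open>auto simp: q0 q_Suc s_def\<close>)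
  then show thesis using vw by (rule that)
qed

section \<open>Uniqueness of CP runs\<close>

text \<open>The right-hand side of each linear system depends only on earlier data, and
  nonsingularity of \<open>P\<close> then fixes its solution and hence all that is computed from it.
  The scalars are compared only at indices where they have been generated.\<close>

lemma cp_lanczos_run_unique:
  assumes P: "invertible (block_matrix G (transpose B) B (- C))"
    and run: "cp_lanczos_run A B C G b x0 q0 K p q \<alpha> \<beta>"
    and run': "cp_lanczos_run A B C G b x0 q0 K p' q' \<alpha>' \<beta>'"
  shows "k \<le> K \<Longrightarrow> p k = p' k \<and> q k = q' k"
    and "1 \<le> k \<Longrightarrow> k \<le> K \<Longrightarrow> \<beta> k = \<beta>' k"
    and "1 \<le> k \<Longrightarrow> k \<le> K \<Longrightarrow> \<beta> k \<noteq> 0 \<Longrightarrow> \<alpha> k = \<alpha>' k"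
proof -
  let ?P = "block_matrix G (transpose B) B (- C)"
  \<comment> \<open>The unnormalised update for both blocks: \<open>f\<close> is the new direction
    (\<open>pbar\<close>, or \<open>q k - z\<close>), and \<open>g\<close> is the sequence of
    normalised vectors.\<close>
  let ?y = "\<lambda>k \<alpha> \<beta> f g. if k = 0 then f else f - \<alpha> k *\<^sub>R g k - \<beta> k *\<^sub>R g (k - 1)"
  \<comment> \<open>All auxiliary sequences are eliminated except the solution of the linear system.
    The first block needs the case split because the initial residual is not
    \<open>A *v p 0\<close>, whereas \<open>C *v q k\<close> is right at 0 as well. The fact is
    generalised so that it applies to both runs.\<close>
  have step: "\<exists>a z. ?P *v stack a z = stack (if k = 0 then b - A *v x0 else A *v p k) (- (C *v q k))
      \<and> \<beta> (Suc k) = sqrt (?y k \<alpha> \<beta> a p \<bullet> (if k = 0 then b - A *v x0 else A *v p k)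
          + ?y k \<alpha> \<beta> (q k - z) q \<bullet> (C *v q k))
      \<and> p (Suc k) = normalise (\<beta> (Suc k)) (?y k \<alpha> \<beta> a p)
      \<and> q (Suc k) = normalise (\<beta> (Suc k)) (?y k \<alpha> \<beta> (q k - z) q)
      \<and> (1 \<le> k \<longrightarrow> \<beta> k \<noteq> 0)"
    if "k < K" "cp_lanczos_run A B C G b x0 q0 K p q \<alpha> \<beta>" for k p q \<alpha> \<beta>
  proof -
    from that(2) show ?thesis
    proof (cases rule: cp_lanczos_runE)
      case (1 u t pbar zbar s yp yq)
      have "u k = (if k = 0 then b - A *v x0 else A *v p k)" "t k = C *v q k"
        using 1(3-5) 1(6)[OF that(1)] 1(7)[of k] that(1) by (cases k; simp)+
      then show ?thesis
        using 1(6)[OF that(1)]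
        by (intro exI[of _ "pbar (Suc k)"] exI[of _ "zbar (Suc k)"]; cases "k = 0"; simp)
    qed
  qed
  have alpha: "\<alpha> k = p k \<bullet> (A *v p k) + q k \<bullet> (C *v q k)"
    if "1 \<le> k" "k \<le> K" "\<beta> k \<noteq> 0" "cp_lanczos_run A B C G b x0 q0 K p q \<alpha> \<beta>" for k p q \<alpha> \<beta>
    using that unfolding cp_lanczos_run_def by metis
  have init: "p 0 = p' 0 \<and> q 0 = q' 0"
    using run run' unfolding cp_lanczos_run_def by metis
  have agree: "p k = p' k \<and> q k = q' k \<and> (1 \<le> k \<longrightarrow> \<beta> k = \<beta>' k)" if "k \<le> K" for k
    using that
  proof (induction k rule: less_induct)
    case (less k)
    show ?case
    proof (cases k)
      case 0
      then show ?thesis using init by simp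
    next
      case (Suc j)
      then have j: "j < K" using less.prems by simp
      have eqs: "p j = p' j" "q j = q' j" "p (j - 1) = p' (j - 1)" "q (j - 1) = q' (j - 1)"
        "1 \<le> j \<Longrightarrow> \<beta> j = \<beta>' j"
        using less.IH[of j] less.IH[of "j - 1"] Suc less.prems by auto
      from step[OF j run] obtain a z where
        az: "?P *v stack a z = stack (if j = 0 then b - A *v x0 else A *v p j) (- (C *v q j))"
        "\<beta> (Suc j) = sqrt (?y j \<alpha> \<beta> a p \<bullet> (if j = 0 then b - A *v x0 else A *v p j)
          + ?y j \<alpha> \<beta> (q j - z) q \<bullet> (C *v q j))"
        "p (Suc j) = normalise (\<beta> (Suc j)) (?y j \<alpha> \<beta> a p)"
        "q (Suc j) = normalise (\<beta> (Suc j)) (?y j \<alpha> \<beta> (q j - z) q)"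
        "1 \<le> j \<longrightarrow> \<beta> j \<noteq> 0"
        by blast
      from step[OF j run'] obtain a' z' where
        az': "?P *v stack a' z' = stack (if j = 0 then b - A *v x0 else A *v p' j) (- (C *v q' j))"
        "\<beta>' (Suc j) = sqrt (?y j \<alpha>' \<beta>' a' p' \<bullet> (if j = 0 then b - A *v x0 else A *v p' j)
          + ?y j \<alpha>' \<beta>' (q' j - z') q' \<bullet> (C *v q' j))"
        "p' (Suc j) = normalise (\<beta>' (Suc j)) (?y j \<alpha>' \<beta>' a' p')"
        "q' (Suc j) = normalise (\<beta>' (Suc j)) (?y j \<alpha>' \<beta>' (q' j - z') q')"
        by blast
      have "?P *v stack a z = ?P *v stack a' z'"
        unfolding az(1) az'(1) by (simp only: eqs)
      then have "stack a z = stack a' z'"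
        using inj_matrix_vector_mult[OF P] by (simp only: inj_eq)
      then have a: "a = a'" and z: "z = z'" by simp_all
      \<comment> \<open>Taking step \<open>j\<close> forces \<open>\<beta> j \<noteq> 0\<close>, so
        both \<alpha> are given by the formula in the already equal vectors. For
        \<open>j = 0\<close> they do not enter \<open>?y\<close>.\<close>
      have "\<alpha> j = \<alpha>' j" if "1 \<le> j"
        using alpha[OF that _ _ run] alpha[OF that _ _ run'] az(5) j eqs that by simp
      then have yp: "?y j \<alpha> \<beta> a p = ?y j \<alpha>' \<beta>' a' p'"
        and yq: "?y j \<alpha> \<beta> (q j - z) q = ?y j \<alpha>' \<beta>' (q' j - z') q'"
        using eqs a z by (cases "j = 0"; simp)+
      have "\<beta> (Suc j) = \<beta>' (Suc j)"
        unfolding az(2) az'(2) yp yq by (simp add: eqs)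
      then show ?thesis
        unfolding Suc az(3,4) az'(3,4) yp yq by simp
    qed
  qed
  show "k \<le> K \<Longrightarrow> p k = p' k \<and> q k = q' k" "1 \<le> k \<Longrightarrow> k \<le> K \<Longrightarrow> \<beta> k = \<beta>' k"
    using agree[of k] by auto
  show "\<alpha> k = \<alpha>' k" if "1 \<le> k" "k \<le> K" "\<beta> k \<noteq> 0"
    using agree[OF that(2)] alpha[OF that run] alpha[OF that(1,2) _ run'] that by simp
qed

text \<open>Equivalence has two halves. The first says that neither process can break off before the
  other; without it the comparison of two runs of equal length could be vacuous.\<close>

theorem theorem3p2:
  fixes A G :: "real^'n^'n" and B :: "real^'n^'m" and C :: "real^'m^'m"
    and E :: "real^'p^'m" and F :: "real^'p^'p"
    and b x0 :: "real^'n" and w0 :: "real^'p" and q0 :: "real^'m"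
  assumes "transpose A = A"
    and "C \<noteq> 0" and "transpose C = C"
    and "invertible (block_matrix A (transpose B) B (- C))"
    and "invertible (block_matrix G (transpose B) B (- C))"
    and "C = E ** F ** transpose E"
    and "transpose F = F" and "invertible F"
    and "CARD('p) = rank C"
    and "transpose (block_matrix G 0 0 (matrix_inv F)) = block_matrix G 0 0 (matrix_inv F)"
    and "pos_def_on_null (block_matrix G 0 0 (matrix_inv F)) (block_row B E)"
    and "w0 = - (F *v (transpose E *v q0))"
    and "B *v x0 + E *v w0 = 0"
  shows "(\<forall>K. (\<exists>vx vw \<alpha> \<beta>. projected_lanczos_run A B E F G b x0 w0 K vx vw \<alpha> \<beta>) \<longleftrightarrow>
             (\<exists>p q \<alpha> \<beta>. cp_lanczos_run A B C G b x0 q0 K p q \<alpha> \<beta>)) \<and>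
         (\<forall>K vx vw \<alpha> \<beta> p q \<alpha>' \<beta>'.
           projected_lanczos_run A B E F G b x0 w0 K vx vw \<alpha> \<beta> \<and>
           cp_lanczos_run A B C G b x0 q0 K p q \<alpha>' \<beta>' \<longrightarrow>
             (\<forall>k\<le>K. vx k = p k \<and> vw k = F *v (transpose E *v q k)) \<and>
             (\<forall>k. 1 \<le> k \<and> k \<le> K \<longrightarrow> \<beta> k = \<beta>' k) \<and>
             (\<forall>k. 1 \<le> k \<and> k \<le> K \<and> \<beta> k \<noteq> 0 \<longrightarrow> \<alpha> k = \<alpha>' k))"
proof (intro conjI allI impI iffI)
  fix K
  assume "\<exists>vx vw \<alpha> \<beta>. projected_lanczos_run A B E F G b x0 w0 K vx vw \<alpha> \<beta>"
  then show "\<exists>p q \<alpha> \<beta>. cp_lanczos_run A B C G b x0 q0 K p q \<alpha> \<beta>"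
    using projected_lanczos_run_imp_cp[of F A B E G b x0 q0 K] assms(6-8,12) by metis
next
  fix K
  assume "\<exists>p q \<alpha> \<beta>. cp_lanczos_run A B C G b x0 q0 K p q \<alpha> \<beta>"
  then show "\<exists>vx vw \<alpha> \<beta>. projected_lanczos_run A B E F G b x0 w0 K vx vw \<alpha> \<beta>"
    using cp_lanczos_run_imp_projected[of F A B E G b x0 q0 K] assms(6-8,12) by metis
next
  fix K vx vw \<alpha> \<beta> p q \<alpha>' \<beta>'
  assume runs: "projected_lanczos_run A B E F G b x0 w0 K vx vw \<alpha> \<beta> \<and>
    cp_lanczos_run A B C G b x0 q0 K p q \<alpha>' \<beta>'"
  \<comment> \<open>The projected run becomes a CP run with the same first-block vectors and
    scalars, so the claim reduces to comparing two CP runs; uniqueness then replaces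
    \<open>q'\<close> by the given \<open>q\<close>.\<close>
  then obtain q' where run: "cp_lanczos_run A B C G b x0 q0 K vx q' \<alpha> \<beta>"
    and vw: "\<And>k. k \<le> K \<Longrightarrow> vw k = F *v (transpose E *v q' k)"
    using projected_lanczos_run_imp_cp[of F A B E G b x0 q0 K vx vw \<alpha> \<beta>] assms(6-8,12)
    by metis
  note unique = cp_lanczos_run_unique[OF assms(5) run conjunct2[OF runs]]
  fix k
  show "vx k = p k" "vw k = F *v (transpose E *v q k)" if "k \<le> K"
    using unique(1)[OF that] vw[OF that] by simp_all
  show "\<beta> k = \<beta>' k" if "1 \<le> k \<and> k \<le> K"
    using unique(2) that by blast
  show "\<alpha> k = \<alpha>' k" if "1 \<le> k \<and> k \<le> K \<and> \<beta> k \<noteq> 0"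
    using unique(3) that by blast
qed

end
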